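(* Suppose $(M,\mathcal{B},\mu)$ is a probability space and $f:M\to M$ is a measurable and measure preserving transformation. Let $X$ be a metric space and $\phi:M\to X^{\mathbb{N}}$ a measurable function, and for integers $0\le m<n$ define $a(m,n):M\to[0,+\infty)$ by $$a_x(m,n)=d(\phi(x)_m,\phi(x)_n).$$ Assume that the functions $a(m,n)$ are measurable and satisfy: (1) $a_x(l,n)\le a_x(l,m)+a_x(m,n)$ for all $x\in M$ and all $0\le l<m<n$; (2) $a_x(m+1,n+1)=a_{f(x)}(m,n)$ for all $x\in M$ and all $0\le m<n$; (3) $\int_M|a_x(0,1)|\,\mathrm{d}\mu(x)<+\infty$; (4) $\lim_{n\to+\infty}\int_M\frac{a_x(0,n)}{n}\,\mathrm{d}\mu(x)>-\infty$. Then for $\mu$-almost every $x\in M$, if the sequence $\phi(x)$ escapes linearly to infinity then it is aligned.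
   Context: Here $\mathbb{N}=\{0,1,2,\dots\}$ and $\phi(x)_n$ denotes the $n$-th term of the sequence $\phi(x)=\{\phi(x)_n\}_{n\ge0}$; $d$ is the distance of $X$. A sequence $\{x_n\}_{n\ge0}$ in a metric space $X$ has rate of escape $R=\lim_{n\to+\infty}\frac{d(x_0,x_n)}{n}$ if this limit exists; it escapes linearly to infinity if it has a positive and finite rate of escape. For $\epsilon\in[0,+\infty]$ and $x,y\in X$, the $\epsilon$-cone from $x$ to $y$ is $[x,y]_\epsilon=\{z\in X: e^{-\epsilon}d(x,z)+d(z,y)\le d(x,y)\}$. A sequence $\{x_n\}_{n\ge0}\subset X$ is aligned if for each $\epsilon>0$ there exists $K\in\mathbb{N}$ such that for infinitely many $n\in\mathbb{N}$ one has $x_k\in[x_0,x_n]_\epsilon$ for all $K\le k\le n$. *)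

theory Defs
  imports "HOL-Probability.Probability"
begin

definition has_rate_of_escape :: "(nat \<Rightarrow> 'a::metric_space) \<Rightarrow> ereal \<Rightarrow> bool" where
  "has_rate_of_escape x R \<longleftrightarrow> (\<lambda>n. ereal (dist (x 0) (x n) / real n)) \<longlonglongrightarrow> R"

definition escapes_linearly :: "(nat \<Rightarrow> 'a::metric_space) \<Rightarrow> bool" where
  "escapes_linearly x \<longleftrightarrow> (\<exists>R. has_rate_of_escape x R \<and> 0 < R \<and> R < \<infinity>)"

(* The case distinction is needed because enn2real \<infinity> = 0, whereas exp (-\<infinity>) must be 0. *)
definition exp_minus :: "ennreal \<Rightarrow> real" where
  "exp_minus \<epsilon> = (if \<epsilon> = \<infinity> then 0 else exp (- enn2real \<epsilon>))"

definition eps_cone :: "ennreal \<Rightarrow> 'a::metric_space \<Rightarrow> 'a \<Rightarrow> 'a set" where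
  "eps_cone \<epsilon> x y = {z. exp_minus \<epsilon> * dist x z + dist z y \<le> dist x y}"

definition aligned :: "(nat \<Rightarrow> 'a::metric_space) \<Rightarrow> bool" where
  "aligned x \<longleftrightarrow>
    (\<forall>\<epsilon>>0. \<exists>K. \<exists>\<^sub>\<infinity>n. \<forall>k. K \<le> k \<and> k \<le> n \<longrightarrow> x k \<in> eps_cone \<epsilon> (x 0) (x n))"

end

theory Submission
  imports Defs
begin

text \<open>
  The displacements $u_n(x) = d(\phi(x)_0, \phi(x)_n)$ form a subadditive cocycle over $f$.
  Fix $b < c$ and let $G$ be the set of points $x$ for which, up to an additive constant,
  $u_n(x) - u_{n-k}(f^k x) \ge b k$ for all $k \le n$ and infinitely many $n$.  On an invariant set
  disjoint from $G$, almost all times are leaders in the sense of F. Riesz, and the increments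
  $u_m - u_{m-1} \circ f - b$ have nonpositive total integral over the leaders; by dominated
  convergence and Cesaro averaging the other times contribute $o(n)$.  Hence the mean of $u_n / n$
  is at most $b$, which is impossible if $u_n \ge c n - C$ and the set has positive measure.
  Since $G$ and the growth condition are exactly invariant, no ergodic theorem is needed.
  Alignment follows by choosing $b$ and $c$ rational with $e^{-\epsilon} R < b < c < R$.
\<close>

section \<open>Real sequences: leaders and Cesaro means\<close>

text \<open>F. Riesz's leader lemma, telescoped: the \<open>t m\<close> are the partial sums read backwards in time.\<close>

lemma leader_sum_le:
  fixes t :: "nat \<Rightarrow> real"
  assumes "k \<le> n"
  shows "(\<Sum>m<n. if \<exists>k\<le>m. t (Suc m) < t k then t (Suc m) - t m else 0) \<le> t n - t k"
  using assms
proof (induction n arbitrary: k)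
  case 0
  then show ?case by simp
next
  case (Suc n)
  show ?case
  proof (cases "\<exists>k\<le>n. t (Suc n) < t k")
    case True
    \<comment> \<open>The old sum is at most \<open>t n - t k\<close>, and the new increment
      telescopes. For \<open>k = Suc n\<close> the bound needed is 0, and the induction hypothesis
      at \<open>j\<close> gives \<open>t (Suc n) - t j < 0\<close>.\<close>
    then obtain j where j: "j \<le> n" "t (Suc n) < t j" by blast
    have "k \<le> n \<or> k = Suc n" using Suc.prems by auto
    then show ?thesis using Suc.IH[of j] Suc.IH[of k] j True by auto
  next
    case False
    \<comment> \<open>The sum is unchanged and is at most 0 by the induction hypothesis at
      \<open>n\<close>, while the right-hand side is nonnegative because \<open>t (Suc n)\<close> is
      a running maximum.\<close>
    then have "t k \<le> t (Suc n)" using Suc.prems by (cases "k = Suc n") (auto simp: not_less)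
    then show ?thesis using Suc.IH[of n] by (simp only: sum.lessThan_Suc False if_False) simp
  qed
qed

lemma cesaro_mean_tendsto_zero:
  fixes e :: "nat \<Rightarrow> real"
  assumes "e \<longlonglongrightarrow> 0"
  shows "(\<lambda>n. (\<Sum>m<n. e m) / real n) \<longlonglongrightarrow> 0"
proof (rule LIMSEQ_I)
  fix r :: real assume r: "0 < r"
  obtain N where N: "\<And>m. m \<ge> N \<Longrightarrow> norm (e m) < r / 2"
    using LIMSEQ_D[OF assms, of "r / 2"] r by auto
  define B where "B = (\<Sum>m<N. \<bar>e m\<bar>)"
  obtain N' :: nat where N': "2 * B / r < real N'" using reals_Archimedean2 by blast
  show "\<exists>n0. \<forall>n\<ge>n0. norm ((\<Sum>m<n. e m) / real n - 0) < r"
  proof (intro exI[of _ "max (Suc N) N'"] allI impI)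
    fix n assume n: "max (Suc N) N' \<le> n"
    have "\<bar>\<Sum>m<n. e m\<bar> \<le> (\<Sum>m<n. \<bar>e m\<bar>)" by (rule sum_abs)
    also have "\<dots> = B + (\<Sum>m=N..<n. \<bar>e m\<bar>)"
      unfolding B_def lessThan_atLeast0 using n by (simp add: sum.atLeastLessThan_concat)
    also have "(\<Sum>m=N..<n. \<bar>e m\<bar>) \<le> (\<Sum>m=N..<n. r / 2)"
      by (rule sum_mono) (use N in \<open>force simp: less_imp_le\<close>)
    also have "\<dots> \<le> real n * (r / 2)" using r by (simp add: mult_right_mono)
    also have "B < real n * (r / 2)"
    proof -
      have "2 * B / r < real n" using N' n by linarith
      then show ?thesis using r by (simp add: field_simps)
    qed
    finally have "\<bar>\<Sum>m<n. e m\<bar> < real n * r" by (simp add: field_simps)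
    then show "norm ((\<Sum>m<n. e m) / real n - 0) < r" using n by (simp add: field_simps)
  qed
qed

section \<open>Displacement cocycles over a measure-preserving map\<close>

text \<open>The model is \<open>u n x\<close> as the distance from point 0 to point \<open>n\<close>
  of a random sequence, with \<open>T\<close> shifting the sequence. Then \<open>u_Suc_le\<close>
  and \<open>u_T_le\<close> are two triangle inequalities for the points 0, 1 and
  \<open>Suc n\<close>; the second bounds the displacement from below and goes beyond
  subadditivity.\<close>

locale displacement_cocycle = finite_measure M for M :: "'m measure" +
  fixes T :: "'m \<Rightarrow> 'm" and u :: "nat \<Rightarrow> 'm \<Rightarrow> real"
  assumes T_measurable [measurable]: "T \<in> measurable M M"
    and distr_T: "distr M M T = M"
    and u_measurable [measurable]: "u n \<in> borel_measurable M"
    and u_zero: "x \<in> space M \<Longrightarrow> u 0 x = 0"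
    and u_nonneg: "x \<in> space M \<Longrightarrow> 0 \<le> u n x"
    and u_Suc_le: "x \<in> space M \<Longrightarrow> u (Suc n) x \<le> u 1 x + u n (T x)"
    and u_T_le: "x \<in> space M \<Longrightarrow> u n (T x) \<le> u 1 x + u (Suc n) x"
    and u_1_integrable: "integrable M (u 1)"
begin

lemma T_space: "x \<in> space M \<Longrightarrow> T x \<in> space M"
  using measurable_space[OF T_measurable] .

lemma T_funpow_measurable [measurable]: "(T ^^ n) \<in> measurable M M"
  by (rule measurable_compose_n) measurable

lemma T_funpow_space: "x \<in> space M \<Longrightarrow> (T ^^ n) x \<in> space M"
  using measurable_space[OF T_funpow_measurable] .

lemma distr_T_funpow: "distr M M (T ^^ n) = M"
proof (induction n)
  case 0
  then show ?case by (simp add: id_def distr_id)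
next
  case (Suc n)
  have "distr M M (T ^^ Suc n) = distr (distr M M (T ^^ n)) M T"
    by (subst distr_distr) simp_all
  then show ?case by (simp only: Suc distr_T)
qed

lemma integral_T_funpow:
  fixes g :: "'m \<Rightarrow> real"
  assumes "g \<in> borel_measurable M"
  shows "(\<integral>x. g ((T ^^ n) x) \<partial>M) = (\<integral>x. g x \<partial>M)"
  using integral_distr[OF T_funpow_measurable assms, of n] by (simp add: distr_T_funpow)

lemma integrable_T_funpow:
  fixes g :: "'m \<Rightarrow> real"
  assumes "integrable M g"
  shows "integrable M (\<lambda>x. g ((T ^^ n) x))"
  using integrable_distr[OF T_funpow_measurable, of n g] assms by (simp add: distr_T_funpow)

lemma u_integrable: "integrable M (u n)"
proof (induction n)
  case 0
  have "integrable M (u 0) \<longleftrightarrow> integrable M (\<lambda>_. 0::real)"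
    by (rule Bochner_Integration.integrable_cong) (auto simp: u_zero)
  then show ?case by simp
next
  case (Suc n)
  have "integrable M (\<lambda>x. u 1 x + u n (T x))"
    using u_1_integrable integrable_T_funpow[OF Suc, of 1] by simp
  then show ?case
  proof (rule Bochner_Integration.integrable_bound)
    show "AE x in M. norm (u (Suc n) x) \<le> norm (u 1 x + u n (T x))"
    proof (rule AE_I2)
      fix x assume "x \<in> space M"
      then show "norm (u (Suc n) x) \<le> norm (u 1 x + u n (T x))"
        using u_Suc_le[of x n] u_nonneg[of x "Suc n"] by simp
    qed
  qed simp
qed

section \<open>Leaders, increments and invariant sets\<close>

text \<open>With \<open>j = Suc m - k\<close>, membership says that at time \<open>n = Suc m\<close>
  the inequality \<open>u n x - u (n - j) ((T ^^ j) x) \<ge> b * j\<close> fails for some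
  \<open>1 \<le> j \<le> n\<close>. Indexing by the remaining time \<open>k\<close> matches the
  backward reading in \<open>leader_sum_le\<close>.\<close>

definition leader :: "real \<Rightarrow> nat \<Rightarrow> 'm set" where
  "leader b m = {x \<in> space M. \<exists>k\<le>m. u (Suc m) x - b * real (Suc m) < u k ((T ^^ (Suc m - k)) x) - b * real k}"

lemma leader_sets [measurable]: "leader b m \<in> sets M"
  unfolding leader_def by measurable

definition increment :: "real \<Rightarrow> nat \<Rightarrow> 'm \<Rightarrow> real" where
  "increment b m x = u (Suc m) x - u m (T x) - b"

lemma increment_integrable: "integrable M (increment b m)"
  unfolding increment_def
  using u_integrable[of "Suc m"] integrable_T_funpow[OF u_integrable[of m], of 1] by auto

text \<open>Invariance is exact, not modulo null sets, so the indicator of \<open>H\<close> is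
  constant along every orbit.\<close>

definition invariant :: "'m set \<Rightarrow> bool" where
  "invariant H \<longleftrightarrow> H \<in> sets M \<and> (\<forall>x\<in>space M. T x \<in> H \<longleftrightarrow> x \<in> H)"

lemma invariant_funpow:
  assumes "invariant H" "x \<in> space M"
  shows "(T ^^ n) x \<in> H \<longleftrightarrow> x \<in> H"
  by (induction n) (use assms T_funpow_space in \<open>auto simp: invariant_def\<close>)

lemma integral_invariant_funpow:
  assumes "invariant H" and [measurable]: "g \<in> borel_measurable M"
  shows "(\<integral>x. indicator H x * g ((T ^^ n) x) \<partial>M) = (\<integral>x. indicator H x * g x \<partial>M :: real)"
proof -
  have [measurable]: "H \<in> sets M" using assms by (simp add: invariant_def)
  have "(\<integral>x. indicator H x * g ((T ^^ n) x) \<partial>M)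
      = (\<integral>x. indicator H ((T ^^ n) x) * g ((T ^^ n) x) \<partial>M)"
    by (rule Bochner_Integration.integral_cong) (use assms in \<open>auto simp: invariant_funpow indicator_def\<close>)
  also have "\<dots> = (\<integral>x. indicator H x * g x \<partial>M)"
    by (rule integral_T_funpow) measurable
  finally show ?thesis .
qed

text \<open>Since \<open>H\<close> and the measure are invariant, the \<open>m\<close>-th integrand
  may be evaluated at \<open>(T ^^ (n - Suc m)) x\<close>. After these shifts all terms refer to the
  same end time \<open>n\<close>, and the leader lemma bounds their sum pointwise.\<close>

lemma integral_leader_increments_nonpos:
  assumes H: "invariant H"
  shows "(\<Sum>m<n. \<integral>x. indicator H x * (indicator (leader b m) x * increment b m x) \<partial>M) \<le> 0"
proof -
  have [measurable]: "H \<in> sets M" using assms by (simp add: invariant_def)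
  have [measurable]: "increment b m \<in> borel_measurable M" for m
    using increment_integrable by auto
  define g where "g m x = indicator (leader b m) x * increment b m x" for m x
  have [measurable]: "g m \<in> borel_measurable M" for m unfolding g_def by measurable
  have gi: "integrable M (g m)" for m
    unfolding g_def using integrable_mult_indicator[OF leader_sets increment_integrable, of b m b m] by simp
  have int: "integrable M (\<lambda>x. indicator H x * g m ((T ^^ k) x))" for m k
    using integrable_mult_indicator[OF _ integrable_T_funpow[OF gi], of H] by simp
  have le: "(\<Sum>m<n. g m ((T ^^ (n - Suc m)) x)) \<le> 0" if x: "x \<in> space M" for x
  proof -
    \<comment> \<open>In the metric model this is the distance from point \<open>n - m\<close> to
      point \<open>n\<close>, minus \<open>b * m\<close>: the end point is fixed and the starting
      point moves backwards.\<close>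
    define t where "t m = u m ((T ^^ (n - m)) x) - b * real m" for m
    have "(\<Sum>m<n. g m ((T ^^ (n - Suc m)) x))
        = (\<Sum>m<n. if \<exists>k\<le>m. t (Suc m) < t k then t (Suc m) - t m else 0)"
    proof (rule sum.cong)
      fix m assume m: "m \<in> {..<n}"
      have eq: "(T ^^ (Suc m - k)) ((T ^^ (n - Suc m)) x) = (T ^^ (n - k)) x" if "k \<le> m" for k
      proof -
        have "n - k = (Suc m - k) + (n - Suc m)" using m that by auto
        then show ?thesis by (simp add: funpow_add)
      qed
      have "T ((T ^^ (n - Suc m)) x) = (T ^^ (n - m)) x" using eq[of m] by (simp add: Suc_diff_le)
      then have "increment b m ((T ^^ (n - Suc m)) x) = t (Suc m) - t m"
        by (simp add: increment_def t_def algebra_simps)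
      moreover have "(T ^^ (n - Suc m)) x \<in> leader b m \<longleftrightarrow> (\<exists>k\<le>m. t (Suc m) < t k)"
        using x T_funpow_space eq unfolding leader_def t_def by auto
      ultimately show "g m ((T ^^ (n - Suc m)) x)
        = (if \<exists>k\<le>m. t (Suc m) < t k then t (Suc m) - t m else 0)"
        by (simp add: g_def)
    qed simp
    \<comment> \<open>Taking \<open>k = n\<close> in the leader lemma gives the bound 0.\<close>
    also have "\<dots> \<le> t n - t n" by (rule leader_sum_le) simp
    finally show ?thesis by simp
  qed
  have "(\<Sum>m<n. \<integral>x. indicator H x * g m x \<partial>M)
      = (\<Sum>m<n. \<integral>x. indicator H x * g m ((T ^^ (n - Suc m)) x) \<partial>M)"
    using integral_invariant_funpow[OF H] by simp
  also have "\<dots> = (\<integral>x. (\<Sum>m<n. indicator H x * g m ((T ^^ (n - Suc m)) x)) \<partial>M)"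
    by (rule Bochner_Integration.integral_sum[symmetric]) (rule int)
  also have "\<dots> \<le> 0"
  proof -
    have "(\<integral>x. (\<Sum>m<n. indicator H x * g m ((T ^^ (n - Suc m)) x)) \<partial>M) \<le> (\<integral>x. 0 \<partial>M)"
    proof (rule integral_mono)
      show "integrable M (\<lambda>x. \<Sum>m<n. indicator H x * g m ((T ^^ (n - Suc m)) x))"
        by (rule Bochner_Integration.integrable_sum) (rule int)
      show "(\<Sum>m<n. indicator H x * g m ((T ^^ (n - Suc m)) x)) \<le> 0" if "x \<in> space M" for x
        using le[OF that] by (simp only: sum_distrib_left[symmetric]) (simp add: mult_nonneg_nonpos)
    qed simp
    then show ?thesis by simp
  qed
  finally show ?thesis by (simp add: g_def)
qed

section \<open>Growth faster than \<open>b\<close> against eventual leadership\<close>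

lemma measure_zero_if_eventually_leader:
  fixes b c :: real
  assumes H: "invariant H"
    and b: "0 \<le> b" "b < c"
    and growth: "\<And>x. x \<in> H \<Longrightarrow> \<exists>C. \<forall>n. c * real n - C \<le> u n x"
    and ev: "\<And>x. x \<in> H \<Longrightarrow> eventually (\<lambda>m. x \<in> leader b m) sequentially"
  shows "measure M H = 0"
proof -
  have [measurable]: "H \<in> sets M" using assms by (simp add: invariant_def)
  have HM: "H \<subseteq> space M" by (rule sets.sets_into_space) simp
  have Hint: "integrable M (\<lambda>x. indicator H x * g x)" if "integrable M g" for g :: "'m \<Rightarrow> real"
    using integrable_mult_indicator[OF _ that, of H] by simp
  \<comment> \<open>This is the error from the times that are not leaders: there the increment is at
    most \<open>u 1 x\<close>. Each point of \<open>H\<close> is eventually a leader, so the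
    integrand tends to 0 under the integrable bound \<open>u 1\<close>.\<close>
  define e where "e m = (\<integral>x. indicator (H - leader b m) x * u 1 x \<partial>M)" for m
  have e0: "e \<longlonglongrightarrow> 0"
  proof -
    have "e \<longlonglongrightarrow> (\<integral>x. 0 \<partial>M)"
      unfolding e_def
    proof (rule integral_dominated_convergence[where w = "u 1"])
      show "AE x in M. (\<lambda>m. indicator (H - leader b m) x * u 1 x) \<longlonglongrightarrow> 0"
      proof (rule AE_I2)
        fix x
        have "eventually (\<lambda>m. indicator (H - leader b m) x * u 1 x = 0) sequentially"
        proof (cases "x \<in> H")
          case True
          show ?thesis by (rule eventually_mono[OF ev[OF True]]) simp
        qed simp
        then show "(\<lambda>m. indicator (H - leader b m) x * u 1 x) \<longlonglongrightarrow> 0"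
          by (rule tendsto_eventually)
      qed
    qed (use u_1_integrable u_nonneg in \<open>auto intro!: AE_I2 simp: indicator_def\<close>)
    then show ?thesis by simp
  qed
  have upper: "(\<integral>x. indicator H x * u n x \<partial>M) - b * real n * measure M H \<le> (\<Sum>m<n. e m)" for n
  proof -
    \<comment> \<open>Invariance of \<open>H\<close> replaces the integral of
      \<open>u m (T x)\<close> over \<open>H\<close> by that of \<open>u m x\<close>, so that the
      integrals of the increments telescope in \<open>m\<close>.\<close>
    have eqm: "(\<integral>x. indicator H x * increment b m x \<partial>M)
       = (\<integral>x. indicator H x * u (Suc m) x \<partial>M) - (\<integral>x. indicator H x * u m x \<partial>M) - b * measure M H" for m
    proof -
      have "(\<integral>x. indicator H x * increment b m x \<partial>M)
        = (\<integral>x. indicator H x * u (Suc m) x - indicator H x * u m (T x) - b * indicator H x \<partial>M)"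
        by (rule Bochner_Integration.integral_cong) (auto simp: increment_def algebra_simps)
      also have "\<dots> = (\<integral>x. indicator H x * u (Suc m) x \<partial>M) - (\<integral>x. indicator H x * u m (T x) \<partial>M) - b * measure M H"
        using Hint[OF u_integrable[of "Suc m"]] Hint[OF integrable_T_funpow[OF u_integrable[of m], of 1]]
          Hint[of "\<lambda>_. 1"] by (simp add: Int_absorb2 HM)
      finally show ?thesis using integral_invariant_funpow[OF H u_measurable, of m 1] by simp
    qed
    have "(\<Sum>m<n. \<integral>x. indicator H x * increment b m x \<partial>M)
       = (\<integral>x. indicator H x * u n x \<partial>M) - (\<integral>x. indicator H x * u 0 x \<partial>M) - b * real n * measure M H"
      by (induction n) (simp_all add: eqm algebra_simps)
    also have "(\<integral>x. indicator H x * u 0 x \<partial>M) = (\<integral>x. 0 \<partial>M)"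
      by (rule Bochner_Integration.integral_cong) (auto simp: u_zero)
    finally have "(\<integral>x. indicator H x * u n x \<partial>M) - b * real n * measure M H
       = (\<Sum>m<n. \<integral>x. indicator H x * increment b m x \<partial>M)" by simp
    \<comment> \<open>The increment is kept on leaders; elsewhere it is bounded by
      \<open>u 1 x\<close>, using subadditivity and \<open>0 \<le> b\<close>.\<close>
    also have "\<dots> \<le> (\<Sum>m<n. (\<integral>x. indicator H x * (indicator (leader b m) x * increment b m x) \<partial>M) + e m)"
    proof (rule sum_mono)
      fix m
      have i1: "integrable M (\<lambda>x. indicator H x * (indicator (leader b m) x * increment b m x))"
        by (rule Hint) (use integrable_mult_indicator[OF leader_sets increment_integrable, of b m b m] in simp)
      have i2: "integrable M (\<lambda>x. indicator (H - leader b m) x * u 1 x)"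
        using integrable_mult_indicator[OF _ u_1_integrable, of "H - leader b m"] by simp
      have "(\<integral>x. indicator H x * increment b m x \<partial>M)
         \<le> (\<integral>x. indicator H x * (indicator (leader b m) x * increment b m x) + indicator (H - leader b m) x * u 1 x \<partial>M)"
      proof (rule integral_mono)
        fix x assume "x \<in> space M"
        then have "increment b m x \<le> u 1 x" using u_Suc_le[of x m] b by (simp add: increment_def)
        then show "indicator H x * increment b m x
           \<le> indicator H x * (indicator (leader b m) x * increment b m x) + indicator (H - leader b m) x * u 1 x"
          by (auto simp: indicator_def)
      qed (use i1 i2 Hint[OF increment_integrable] in auto)
      then show "(\<integral>x. indicator H x * increment b m x \<partial>M)
         \<le> (\<integral>x. indicator H x * (indicator (leader b m) x * increment b m x) \<partial>M) + e m"
        using i1 i2 by (simp add: e_def)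
    qed
    also have "\<dots> \<le> (\<Sum>m<n. e m)"
      using integral_leader_increments_nonpos[OF H, of b n] by (simp only: sum.distrib)
    finally show ?thesis .
  qed
  \<comment> \<open>Truncation at \<open>c\<close> provides a constant dominating function. The
    growth hypothesis forces the truncated quotients to converge to \<open>c\<close> on
    \<open>H\<close>, so the integrals converge to \<open>c * measure M H\<close>.\<close>
  define h where "h n x = indicator H x * min c (u n x / real n)" for n x
  have [measurable]: "h n \<in> borel_measurable M" for n unfolding h_def by measurable
  have hb: "norm (h n x) \<le> c" if "x \<in> space M" for n x
    using b u_nonneg[OF that, of n] by (auto simp: h_def indicator_def)
  have hi: "integrable M (h n)" for n
    by (rule integrable_const_bound[where B = c]) (use hb in auto)
  have "(\<lambda>n. \<integral>x. h n x \<partial>M) \<longlonglongrightarrow> (\<integral>x. c * indicator H x \<partial>M)"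
  proof (rule integral_dominated_convergence[where w = "\<lambda>_. c"])
    show "AE x in M. (\<lambda>n. h n x) \<longlonglongrightarrow> c * indicator H x"
    proof (rule AE_I2)
      fix x
      show "(\<lambda>n. h n x) \<longlonglongrightarrow> c * indicator H x"
      proof (cases "x \<in> H")
        case True
        obtain C where C: "\<And>n. c * real n - C \<le> u n x" using growth[OF True] by blast
        have "(\<lambda>n. min c (u n x / real n)) \<longlonglongrightarrow> c"
        proof (rule tendsto_sandwich)
          have "(\<lambda>n. c - \<bar>C\<bar> * (1 / real n)) \<longlonglongrightarrow> c - \<bar>C\<bar> * 0"
            by (intro tendsto_intros lim_1_over_n)
          then show "(\<lambda>n. c - \<bar>C\<bar> * (1 / real n)) \<longlonglongrightarrow> c" by simp
          show "eventually (\<lambda>n. c - \<bar>C\<bar> * (1 / real n) \<le> min c (u n x / real n)) sequentially"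
          proof (rule eventually_sequentiallyI[of 1])
            fix n :: nat assume "1 \<le> n"
            moreover have "c * real n - \<bar>C\<bar> \<le> u n x" using C[of n] by linarith
            ultimately have "c - \<bar>C\<bar> / real n \<le> u n x / real n"
              by (simp add: pos_le_divide_eq left_diff_distrib)
            then show "c - \<bar>C\<bar> * (1 / real n) \<le> min c (u n x / real n)"
              by simp
          qed
        qed auto
        then show ?thesis using True by (simp add: h_def)
      qed (simp add: h_def)
    qed
  qed (use hb in \<open>auto intro!: AE_I2\<close>)
  then have lim1: "(\<lambda>n. (\<integral>x. h n x \<partial>M) - b * measure M H) \<longlonglongrightarrow> c * measure M H - b * measure M H"
    by (intro tendsto_intros) (simp add: Int_absorb2 HM)
  have "c * measure M H - b * measure M H \<le> 0"
  proof (rule tendsto_le[OF _ cesaro_mean_tendsto_zero[OF e0] lim1])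
    show "eventually (\<lambda>n. (\<integral>x. h n x \<partial>M) - b * measure M H \<le> (\<Sum>m<n. e m) / real n) sequentially"
    proof (rule eventually_sequentiallyI[of 1])
      fix n :: nat assume n: "1 \<le> n"
      have "(\<integral>x. h n x \<partial>M) \<le> (\<integral>x. indicator H x * u n x / real n \<partial>M)"
      proof (rule integral_mono)
        show "integrable M (\<lambda>x. indicator H x * u n x / real n)"
          using Hint[OF u_integrable[of n]] by simp
        show "h n x \<le> indicator H x * u n x / real n" for x
          by (simp add: h_def indicator_def)
      qed (rule hi)
      then have "(\<integral>x. h n x \<partial>M) - b * measure M H \<le> ((\<integral>x. indicator H x * u n x \<partial>M) - b * real n * measure M H) / real n"
        using n by (simp add: field_simps)
      also have "\<dots> \<le> (\<Sum>m<n. e m) / real n"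
        using upper[of n] by (rule divide_right_mono) simp
      finally show "(\<integral>x. h n x \<partial>M) - b * measure M H \<le> (\<Sum>m<n. e m) / real n" .
    qed
  qed simp
  then have "(c - b) * measure M H \<le> 0" by (simp add: algebra_simps)
  then show ?thesis using b measure_nonneg[of M H] by (simp add: mult_le_0_iff)
qed

section \<open>The invariant sets \<open>good\<close> and \<open>growing\<close>\<close>

text \<open>The additive constant \<open>C\<close> is what makes this set exactly invariant.\<close>

definition good :: "real \<Rightarrow> 'm set" where
  "good b = {x \<in> space M. \<exists>C::nat. \<exists>\<^sub>\<infinity>n. \<forall>k\<le>n. b * real k - real C \<le> u n x - u (n - k) ((T ^^ k) x)}"

text \<open>Taking the constant in \<open>nat\<close> makes this a countable union, which gives
  measurability; the same holds for \<open>good\<close>.\<close>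

definition growing :: "real \<Rightarrow> 'm set" where
  "growing c = {x \<in> space M. \<exists>C::nat. \<forall>n. c * real n - real C \<le> u n x}"

lemma good_sets [measurable]: "good b \<in> sets M"
  unfolding good_def INFM_nat_le by measurable

lemma growing_sets [measurable]: "growing c \<in> sets M"
  unfolding growing_def by measurable

lemma invariant_growing:
  assumes "0 \<le> c"
  shows "invariant (growing c)"
  unfolding invariant_def
proof (intro conjI ballI iffI)
  show "growing c \<in> sets M" by simp
next
  fix x assume x: "x \<in> space M" and "T x \<in> growing c"
  then obtain C where C: "\<And>n. c * real n - real C \<le> u n (T x)" by (auto simp: growing_def)
  \<comment> \<open>The term \<open>c\<close> pays for the index shift from \<open>m\<close> to
    \<open>Suc m\<close>, and \<open>u 1 x\<close> for the triangle inequality. In the opposite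
    direction the shift helps, because \<open>0 \<le> c\<close>.\<close>
  obtain D :: nat where D: "real C + c + u 1 x \<le> real D" using real_arch_simple by blast
  have "c * real n - real D \<le> u n x" for n
  proof (cases n)
    case 0
    then show ?thesis by (simp add: u_zero x)
  next
    case (Suc m)
    then show ?thesis using C[of m] u_T_le[OF x, of m] D by (simp add: algebra_simps)
  qed
  then show "x \<in> growing c" using x by (auto simp: growing_def)
next
  fix x assume x: "x \<in> space M" and "x \<in> growing c"
  then obtain C where C: "\<And>n. c * real n - real C \<le> u n x" by (auto simp: growing_def)
  obtain D :: nat where D: "real C + u 1 x \<le> real D" using real_arch_simple by blast
  have "c * real n - real D \<le> u n (T x)" for n
    using C[of "Suc n"] u_Suc_le[OF x, of n] D assms by (simp add: algebra_simps)
  then show "T x \<in> growing c" using T_space[OF x] by (auto simp: growing_def)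
qed

text \<open>The pair \<open>(n, k)\<close> for \<open>T x\<close> corresponds to
  \<open>(Suc n, Suc k)\<close> for \<open>x\<close>, and the subtracted terms then coincide. Only
  \<open>u n (T x)\<close> and \<open>u (Suc n) x\<close> differ, by at most \<open>u 1 x\<close>,
  which the new constant absorbs.\<close>

lemma invariant_good:
  assumes "0 \<le> b"
  shows "invariant (good b)"
  unfolding invariant_def
proof (intro conjI ballI iffI)
  show "good b \<in> sets M" by simp
next
  fix x assume x: "x \<in> space M" and "T x \<in> good b"
  then obtain C where C: "\<exists>\<^sub>\<infinity>n. \<forall>k\<le>n. b * real k - real C \<le> u n (T x) - u (n - k) ((T ^^ k) (T x))"
    by (auto simp: good_def)
  obtain D :: nat where D: "real C + b + u 1 x \<le> real D" using real_arch_simple by blast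
  have step: "\<forall>k\<le>Suc n. b * real k - real D \<le> u (Suc n) x - u (Suc n - k) ((T ^^ k) x)"
    if "\<forall>k\<le>n. b * real k - real C \<le> u n (T x) - u (n - k) ((T ^^ k) (T x))" for n
  proof (intro allI impI)
    fix k assume "k \<le> Suc n"
    show "b * real k - real D \<le> u (Suc n) x - u (Suc n - k) ((T ^^ k) x)"
    proof (cases k)
      case (Suc j)
      then have "b * real j - real C \<le> u n (T x) - u (n - j) ((T ^^ j) (T x))"
        using that \<open>k \<le> Suc n\<close> by simp
      then show ?thesis using u_T_le[OF x, of n] D Suc by (simp add: algebra_simps funpow_swap1)
    qed simp
  qed
  have "\<exists>\<^sub>\<infinity>n. \<forall>k\<le>n. b * real k - real D \<le> u n x - u (n - k) ((T ^^ k) x)"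
    unfolding INFM_nat_le
  proof
    fix N
    obtain n where "n \<ge> N" "\<forall>k\<le>n. b * real k - real C \<le> u n (T x) - u (n - k) ((T ^^ k) (T x))"
      using C unfolding INFM_nat_le by blast
    then show "\<exists>n\<ge>N. \<forall>k\<le>n. b * real k - real D \<le> u n x - u (n - k) ((T ^^ k) x)"
      using step by (intro exI[of _ "Suc n"]) simp
  qed
  then show "x \<in> good b" using x by (auto simp: good_def)
next
  fix x assume x: "x \<in> space M" and "x \<in> good b"
  then obtain C where C: "\<exists>\<^sub>\<infinity>n. \<forall>k\<le>n. b * real k - real C \<le> u n x - u (n - k) ((T ^^ k) x)"
    by (auto simp: good_def)
  obtain D :: nat where D: "real C + u 1 x \<le> real D" using real_arch_simple by blast
  have step: "\<forall>k\<le>n. b * real k - real D \<le> u n (T x) - u (n - k) ((T ^^ k) (T x))"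
    if "\<forall>k\<le>Suc n. b * real k - real C \<le> u (Suc n) x - u (Suc n - k) ((T ^^ k) x)" for n
  proof (intro allI impI)
    fix k assume "k \<le> n"
    then have "b * real (Suc k) - real C \<le> u (Suc n) x - u (Suc n - Suc k) ((T ^^ Suc k) x)"
      using that by blast
    then show "b * real k - real D \<le> u n (T x) - u (n - k) ((T ^^ k) (T x))"
      using u_Suc_le[OF x, of n] D assms by (simp add: algebra_simps funpow_swap1)
  qed
  have "\<exists>\<^sub>\<infinity>n. \<forall>k\<le>n. b * real k - real D \<le> u n (T x) - u (n - k) ((T ^^ k) (T x))"
    unfolding INFM_nat_le
  proof
    fix N
    obtain n where n: "n \<ge> Suc N" "\<forall>k\<le>n. b * real k - real C \<le> u n x - u (n - k) ((T ^^ k) x)"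
      using C unfolding INFM_nat_le by blast
    then obtain m where "n = Suc m" by (cases n) auto
    with n show "\<exists>n\<ge>N. \<forall>k\<le>n. b * real k - real D \<le> u n (T x) - u (n - k) ((T ^^ k) (T x))"
      using step[of m] by (intro exI[of _ m]) simp
  qed
  then show "T x \<in> good b" using T_space[OF x] by (auto simp: good_def)
qed

section \<open>Almost every growing point is good\<close>

lemma AE_growing_imp_good:
  assumes b: "0 \<le> b" "b < c"
  shows "AE x in M. x \<in> growing c \<longrightarrow> x \<in> good b"
proof -
  define H where "H = growing c - good b"
  have Hs [measurable]: "H \<in> sets M" unfolding H_def by measurable
  have "measure M H = 0"
  proof (rule measure_zero_if_eventually_leader[OF _ b])
    show "invariant H"
      using invariant_growing[of c] invariant_good[of b] b by (auto simp: invariant_def H_def)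
    show "\<exists>C. \<forall>n. c * real n - C \<le> u n x" if "x \<in> H" for x
      using that by (auto simp: H_def growing_def)
    show "eventually (\<lambda>m. x \<in> leader b m) sequentially" if "x \<in> H" for x
    proof -
      have x: "x \<in> space M" "x \<notin> good b" using that by (auto simp: H_def growing_def)
      \<comment> \<open>Failure of \<open>good\<close> excludes every additive constant; the
        constant 0 is the case that produces leaders.\<close>
      then have "\<not> (\<exists>\<^sub>\<infinity>n. \<forall>k\<le>n. b * real k - real 0 \<le> u n x - u (n - k) ((T ^^ k) x))"
        unfolding good_def by blast
      then obtain N where "\<not> (\<exists>n\<ge>N. \<forall>k\<le>n. b * real k - real 0 \<le> u n x - u (n - k) ((T ^^ k) x))"
        unfolding INFM_nat_le by blast
      then have N: "\<exists>k\<le>n. u n x - u (n - k) ((T ^^ k) x) < b * real k" if "n \<ge> N" for n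
        using that by (auto simp flip: not_le)
      show ?thesis
      proof (rule eventually_sequentiallyI[of N])
        fix m assume "N \<le> m"
        then obtain k where k: "k \<le> Suc m" "u (Suc m) x - u (Suc m - k) ((T ^^ k) x) < b * real k"
          using N[of "Suc m"] by auto
        \<comment> \<open>At \<open>k = 0\<close> the strict inequality would read
          \<open>0 < 0\<close>. Hence \<open>Suc m - k \<le> m\<close>, and this remaining time is
          the witness for \<open>leader\<close>.\<close>
        have "k \<noteq> 0" using k by (intro notI) simp
        then have "u (Suc m) x - b * real (Suc m)
            < u (Suc m - k) ((T ^^ (Suc m - (Suc m - k))) x) - b * real (Suc m - k)"
          using k by (simp add: of_nat_diff algebra_simps)
        moreover have "Suc m - k \<le> m" using \<open>k \<noteq> 0\<close> by simp
        ultimately show "x \<in> leader b m" using x unfolding leader_def by blast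
      qed
    qed
  qed
  then have "H \<in> null_sets M" by (simp add: null_sets_def emeasure_eq_measure)
  then show ?thesis
    by (rule AE_I') (use sets.sets_into_space[OF growing_sets] in \<open>auto simp: H_def\<close>)
qed

end

section \<open>From displacement cocycles to alignment\<close>

theorem theorem14:
  fixes M :: "'m measure" and f :: "'m \<Rightarrow> 'm"
    and \<phi> :: "'m \<Rightarrow> nat \<Rightarrow> 'x::metric_space"
    and a :: "nat \<Rightarrow> nat \<Rightarrow> 'm \<Rightarrow> real"
  assumes "prob_space M"
    and "f \<in> measurable M M" and "distr M M f = M"
    and "\<phi> \<in> measurable M (\<Pi>\<^sub>M n\<in>UNIV. borel)"
    and "\<And>m n x. m < n \<Longrightarrow> x \<in> space M \<Longrightarrow> a m n x = dist (\<phi> x m) (\<phi> x n)"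
    and "\<And>m n. m < n \<Longrightarrow> a m n \<in> borel_measurable M"
    and "\<And>l m n x. l < m \<Longrightarrow> m < n \<Longrightarrow> x \<in> space M \<Longrightarrow> a l n x \<le> a l m x + a m n x"
    and "\<And>m n x. m < n \<Longrightarrow> x \<in> space M \<Longrightarrow> a (m + 1) (n + 1) x = a m n (f x)"
    and "(\<integral>\<^sup>+ x. ennreal \<bar>a 0 1 x\<bar> \<partial>M) < \<infinity>"
    and "\<exists>L::ereal. (\<lambda>n. ereal (\<integral> x. a 0 n x / real n \<partial>M)) \<longlonglongrightarrow> L \<and> L > -\<infinity>"
  shows "AE x in M. escapes_linearly (\<phi> x) \<longrightarrow> aligned (\<phi> x)"
proof -
  interpret prob_space M by fact
  define u where "u n x = dist (\<phi> x 0) (\<phi> x n)" for n x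
  have fspace: "f x \<in> space M" if "x \<in> space M" for x
    using measurable_space[OF assms(2) that] .
  have shift: "dist (\<phi> (f x) m) (\<phi> (f x) n) = dist (\<phi> x (Suc m)) (\<phi> x (Suc n))"
    if x: "x \<in> space M" for x m n
  proof -
    have *: "dist (\<phi> (f x) m) (\<phi> (f x) n) = dist (\<phi> x (Suc m)) (\<phi> x (Suc n))" if "m < n" for m n
      using assms(8)[OF that x] assms(5)[OF that fspace[OF x]] assms(5)[of "m+1" "n+1" x] that x by simp
    consider "m < n" | "n < m" | "m = n" by linarith
    then show ?thesis by cases (use *[of m n] *[of n m] in \<open>auto simp: dist_commute\<close>)
  qed
  \<comment> \<open>This identifies the subtracted term in \<open>good\<close> with the distance
    from the \<open>k\<close>-th to the \<open>n\<close>-th point.\<close>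
  have orbit: "u (n - k) ((f ^^ k) x) = dist (\<phi> x k) (\<phi> x n)" if "x \<in> space M" "k \<le> n" for x k n
  proof -
    have "dist (\<phi> ((f ^^ k) x) i) (\<phi> ((f ^^ k) x) j) = dist (\<phi> x (i + k)) (\<phi> x (j + k))" for i j
      using that(1)
    proof (induction k arbitrary: x)
      case (Suc k)
      then show ?case using Suc.IH[OF fspace[OF Suc.prems]] shift[OF Suc.prems]
        by (simp add: funpow_swap1)
    qed simp
    from this[of 0 "n - k"] show ?thesis using that(2) by (simp add: u_def)
  qed
  have um: "u n \<in> borel_measurable M" for n
  proof (cases n)
    case 0
    then show ?thesis by (simp add: u_def[abs_def])
  next
    case (Suc m)
    have "u n \<in> borel_measurable M \<longleftrightarrow> a 0 n \<in> borel_measurable M"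
      by (rule measurable_cong) (use assms(5)[of 0 n] Suc in \<open>simp add: u_def\<close>)
    then show ?thesis using assms(6)[of 0 n] Suc by simp
  qed
  interpret displacement_cocycle M f u
  proof
    show "f \<in> measurable M M" "distr M M f = M" by fact+
    show "u n \<in> borel_measurable M" for n by (rule um)
    show "u 0 x = 0" for x by (simp add: u_def)
    show "0 \<le> u n x" for n x by (simp add: u_def)
    show "u (Suc n) x \<le> u 1 x + u n (f x)" if "x \<in> space M" for n x
      using shift[OF that, of 0 n] by (simp add: u_def dist_triangle)
    show "u n (f x) \<le> u 1 x + u (Suc n) x" if "x \<in> space M" for n x
      using shift[OF that, of 0 n] by (simp add: u_def dist_triangle3 dist_commute)
    have "integrable M (a 0 1)"
      using assms(6)[of 0 1] assms(9) by (simp add: integrable_iff_bounded)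
    moreover have "integrable M (a 0 1) \<longleftrightarrow> integrable M (u 1)"
      by (rule Bochner_Integration.integrable_cong) (use assms(5)[of 0 1] in \<open>auto simp: u_def\<close>)
    ultimately show "integrable M (u 1)" by simp
  qed
  \<comment> \<open>The rate \<open>R\<close> depends on \<open>x\<close>, and uncountably many
    \<open>\<epsilon>\<close> occur. Rational pairs leave only countably many exceptional null
    sets.\<close>
  have "AE x in M. \<forall>p::rat. \<forall>q::rat. 0 \<le> p \<and> p < q \<longrightarrow> x \<in> growing (of_rat q) \<longrightarrow> x \<in> good (of_rat p)"
    unfolding AE_all_countable
  proof (intro allI)
    fix p q :: rat
    show "AE x in M. 0 \<le> p \<and> p < q \<longrightarrow> x \<in> growing (of_rat q) \<longrightarrow> x \<in> good (of_rat p)"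
    proof (cases "0 \<le> p \<and> p < q")
      case True
      then show ?thesis using AE_growing_imp_good[of "of_rat p" "of_rat q"] by (simp add: of_rat_less)
    qed auto
  qed
  then show ?thesis
  proof (rule AE_mp, intro AE_I2 impI)
    fix x assume x: "x \<in> space M"
      and ae: "\<forall>p::rat. \<forall>q::rat. 0 \<le> p \<and> p < q \<longrightarrow> x \<in> growing (of_rat q) \<longrightarrow> x \<in> good (of_rat p)"
      and esc: "escapes_linearly (\<phi> x)"
    obtain R where R: "(\<lambda>n. u n x / real n) \<longlonglongrightarrow> R" "0 < R"
    proof -
      obtain R' where R': "has_rate_of_escape (\<phi> x) R'" "0 < R'" "R' < \<infinity>"
        using esc unfolding escapes_linearly_def by blast
      then obtain r where "R' = ereal r" by (cases R') auto
      with R' show ?thesis using that[of r] by (simp add: has_rate_of_escape_def u_def)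
    qed
    show "aligned (\<phi> x)"
      unfolding aligned_def
    proof (intro allI impI)
      fix \<epsilon> :: ennreal assume "0 < \<epsilon>"
      define s where "s = exp_minus \<epsilon>"
      have s: "0 \<le> s" "s < 1"
        using \<open>0 < \<epsilon>\<close> by (auto simp: s_def exp_minus_def enn2real_positive_iff less_top)
      then have "s * R < R" using R(2) by simp
      \<comment> \<open>In \<open>s * R < p < q < R\<close>, the gap below \<open>R\<close> gives
        growth at rate \<open>q\<close>, the middle gap gives \<open>good\<close> at rate
        \<open>p\<close>, and the gap above \<open>s * R\<close> later absorbs the additive
        constant.\<close>
      then obtain p where p: "s * R < of_rat p" "of_rat p < R" using of_rat_dense by blast
      then obtain q where q: "of_rat p < (of_rat q :: real)" "of_rat q < R" using of_rat_dense by blast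
      have pq: "0 \<le> p" "p < q"
      proof -
        have "0 \<le> s * R" using s R by simp
        then have "0 < (of_rat p :: real)" using p by linarith
        then show "0 \<le> p" by simp
        show "p < q" using q by (simp add: of_rat_less)
      qed
      define b where "b = (of_rat p :: real)"
      define c where "c = (of_rat q :: real)"
      have "x \<in> growing c"
      proof -
        obtain N where N: "\<And>n. n \<ge> N \<Longrightarrow> c < u n x / real n"
          using order_tendstoD(1)[OF R(1), of c] q by (auto simp: c_def eventually_sequentially)
        have c0: "0 \<le> c" using pq by (simp add: c_def)
        \<comment> \<open>Large enough to make the left-hand side nonpositive for
          \<open>n \<le> Suc N\<close>, where only nonnegativity of \<open>u n x\<close> is
          available.\<close>
        obtain C :: nat where C: "c * real (Suc N) \<le> real C" using real_arch_simple by blast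
        have "c * real n - real C \<le> u n x" for n
        proof (cases "n \<le> Suc N")
          case True
          then have "c * real n \<le> c * real (Suc N)" using c0 by (intro mult_left_mono) auto
          then show ?thesis using C u_nonneg[OF x, of n] by linarith
        next
          case False
          then show ?thesis using N[of n] C by (simp add: field_simps)
        qed
        then show ?thesis using x by (auto simp: growing_def)
      qed
      then have "x \<in> good b" using ae pq by (auto simp: b_def c_def)
      then obtain C :: nat where C: "\<exists>\<^sub>\<infinity>n. \<forall>k\<le>n. b * real k - real C \<le> u n x - u (n - k) ((f ^^ k) x)"
        by (auto simp: good_def)
      have "(\<lambda>k. s * (u k x / real k) + real C * (1 / real k)) \<longlonglongrightarrow> s * R + real C * 0"
        by (intro tendsto_intros R lim_1_over_n)
      then have "eventually (\<lambda>k. s * (u k x / real k) + real C * (1 / real k) < b) sequentially"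
        by (rule order_tendstoD(2)) (use p in \<open>simp add: b_def\<close>)
      then obtain K where K: "\<And>k. k \<ge> K \<Longrightarrow> s * (u k x / real k) + real C * (1 / real k) < b"
        by (auto simp: eventually_sequentially)
      \<comment> \<open>The limit \<open>s * R < b\<close> leaves linear room for \<open>C\<close>.
        Starting at \<open>Suc K\<close> ensures \<open>k > 0\<close>, so that the division by
        \<open>k\<close> can be cleared.\<close>
      have K': "s * u k x \<le> b * real k - real C" if "k \<ge> Suc K" for k
        using K[of k] that by (simp add: field_simps)
      show "\<exists>K. \<exists>\<^sub>\<infinity>n. \<forall>k. K \<le> k \<and> k \<le> n \<longrightarrow> \<phi> x k \<in> eps_cone \<epsilon> (\<phi> x 0) (\<phi> x n)"
      \<comment> \<open>The threshold does not depend on \<open>n\<close>. For each of the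
        infinitely many \<open>n\<close> from \<open>good\<close>, \<open>s * u k x \<le> b * k - C
        \<le> u n x - dist (\<phi> x k) (\<phi> x n)\<close>, which is the cone inequality.\<close>
      proof (intro exI[of _ "Suc K"], rule frequently_elim1[OF C], intro allI impI)
        fix n k
        assume n: "\<forall>k\<le>n. b * real k - real C \<le> u n x - u (n - k) ((f ^^ k) x)"
          and k: "Suc K \<le> k \<and> k \<le> n"
        then have "b * real k - real C \<le> u n x - dist (\<phi> x k) (\<phi> x n)"
          using orbit[OF x, of k n] by auto
        then show "\<phi> x k \<in> eps_cone \<epsilon> (\<phi> x 0) (\<phi> x n)"
          using K'[of k] k by (simp add: eps_cone_def s_def u_def)
      qed
    qed
  qed
qed

end
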